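(* There are absolute constants $c,c'>0$ such that for infinitely many natural numbers $n$ there is a function $f_n:\{0,1\}^{n^2}\to\{0,1\}$ with $bs(f_n)\le c\,n$ and $bs^*(f_n)\ge c'\,n^{3/2}$. Therefore $\mathrm{crit}(bs^*,bs)\ge 3/2$.
   Context: For $x\in\{0,1\}^N$ and $B\subseteq[N]$, $x\oplus B$ is $x$ with the bits in $B$ flipped; a block of $f$ at $x$ is $B$ with $f(x\oplus B)\ne f(x)$. $bs_x(f)$ is the maximum number of pairwise disjoint blocks at $x$; $bs^*_x(f)$ is the maximum of $\sum_B\lambda(B)$ over nonnegative $\lambda$ on blocks at $x$ with $\sum_{B\ni i}\lambda(B)\le1$ for every $i$; $m(f)=\max_x m_x(f)$. For complexity measures $a,b$ (maps from boolean functions to reals), write $a\le_r b$ if there are constants $C_1,C_2$ with $a(f)\le C_1 b(f)^r+C_2$ for every boolean function $f$; $\mathrm{crit}(a,b)$ is the infimum of all $r$ with $a\le_r b$. *)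

theory Defs
  imports "HOL-Library.Disjoint_Sets" "HOL-Library.Extended_Real"
begin

text \<open>
  A boolean function on \<open>N\<close> bits is given by \<open>N\<close> together with \<open>f :: bool list \<Rightarrow> bool\<close>, of which only
  the values on lists of length \<open>N\<close> are ever used. Coordinates are numbered \<open>0, \<dots>, N - 1\<close>.
\<close>

type_synonym complexity_measure = "nat \<Rightarrow> (bool list \<Rightarrow> bool) \<Rightarrow> real"

definition cube :: "nat \<Rightarrow> bool list set" where
  "cube N = {x. length x = N}"

definition flip :: "bool list \<Rightarrow> nat set \<Rightarrow> bool list" where
  "flip x B = map (\<lambda>i. if i \<in> B then \<not> x ! i else x ! i) [0..<length x]"

definition blocks :: "nat \<Rightarrow> (bool list \<Rightarrow> bool) \<Rightarrow> bool list \<Rightarrow> nat set set" where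
  "blocks N f x = {B. B \<subseteq> {..<N} \<and> f (flip x B) \<noteq> f x}"

definition bs_at :: "nat \<Rightarrow> (bool list \<Rightarrow> bool) \<Rightarrow> bool list \<Rightarrow> nat" where
  "bs_at N f x = Max {card P | P. P \<subseteq> blocks N f x \<and> disjoint P}"

definition bs :: "nat \<Rightarrow> (bool list \<Rightarrow> bool) \<Rightarrow> nat" where
  "bs N f = Max (bs_at N f ` cube N)"

definition fractional_packing ::
  "nat \<Rightarrow> (bool list \<Rightarrow> bool) \<Rightarrow> bool list \<Rightarrow> (nat set \<Rightarrow> real) \<Rightarrow> bool" where
  "fractional_packing N f x w \<longleftrightarrow>
     (\<forall>B \<in> blocks N f x. w B \<ge> 0) \<and>
     (\<forall>i < N. (\<Sum>B \<in> {B \<in> blocks N f x. i \<in> B}. w B) \<le> 1)"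

text \<open>
  The set of packing values is infinite in general, so its maximum is written as \<open>Sup\<close>; it is the
  optimum of a feasible bounded linear program (the bound is \<open>N\<close>, see below), hence attained.
\<close>

definition bs_star_at :: "nat \<Rightarrow> (bool list \<Rightarrow> bool) \<Rightarrow> bool list \<Rightarrow> real" where
  "bs_star_at N f x = Sup {(\<Sum>B \<in> blocks N f x. w B) | w. fractional_packing N f x w}"

definition bs_star :: complexity_measure where
  "bs_star N f = Max (bs_star_at N f ` cube N)"

definition le_exp :: "real \<Rightarrow> complexity_measure \<Rightarrow> complexity_measure \<Rightarrow> bool" where
  "le_exp r a b \<longleftrightarrow> (\<exists>C\<^sub>1 C\<^sub>2 :: real. \<forall>N f. a N f \<le> C\<^sub>1 * b N f powr r + C\<^sub>2)"

text \<open>Extended reals, so that the infimum is \<open>\<infinity>\<close> if no exponent works.\<close>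

definition crit :: "complexity_measure \<Rightarrow> complexity_measure \<Rightarrow> ereal" where
  "crit a b = Inf {ereal r | r. le_exp r a b}"

lemma finite_blocks: "finite (blocks N f x)"
  by (rule finite_subset[of _ "Pow {..<N}"]) (auto simp: blocks_def)

lemma flip_empty: "flip x {} = x"
  by (simp add: flip_def map_nth)

lemma fractional_packing_zero: "fractional_packing N f x (\<lambda>_. 0)"
  by (simp add: fractional_packing_def)

lemma fractional_packing_le:
  assumes "fractional_packing N f x w"
  shows "(\<Sum>B \<in> blocks N f x. w B) \<le> real N"
proof -
  let ?S = "blocks N f x"
  have fin: "finite ?S" by (rule finite_blocks)
  have nonneg: "w B \<ge> 0" if "B \<in> ?S" for B
    using assms that by (auto simp: fractional_packing_def)
  have "(\<Sum>B \<in> ?S. w B) \<le> (\<Sum>B \<in> ?S. \<Sum>i<N. if i \<in> B then w B else 0)"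
  proof (rule sum_mono)
    fix B assume B: "B \<in> ?S"
    then have "B \<noteq> {}" and sub: "B \<subseteq> {..<N}" by (auto simp: blocks_def flip_empty)
    then obtain i where "i \<in> B" "i < N" by auto
    then have "w B = (if i \<in> B then w B else 0)" by simp
    also have "\<dots> \<le> (\<Sum>i<N. if i \<in> B then w B else 0)"
      using \<open>i < N\<close> nonneg[OF B] by (intro member_le_sum) auto
    finally show "w B \<le> (\<Sum>i<N. if i \<in> B then w B else 0)" .
  qed
  also have "\<dots> = (\<Sum>i<N. \<Sum>B \<in> {B \<in> ?S. i \<in> B}. w B)"
    by (subst sum.swap) (simp add: sum.inter_filter[OF fin])
  also have "\<dots> \<le> (\<Sum>i<N. 1)"
    using assms by (intro sum_mono) (auto simp: fractional_packing_def)
  finally show ?thesis by simp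
qed

end

theory Submission
  imports Defs "HOL-Real_Asymp.Real_Asymp"
begin

text \<open>
  Write \<open>n = m\<^sup>2\<close> and read \<open>n\<^sup>2\<close> bits as \<open>n\<close> boolean \<open>m \<times> m\<close> grids. The witness accepts if the ones in
  some grid form a cross, that is, the union of row \<open>v\<close> and column \<open>v\<close> for some \<open>v < m\<close>.

  At an accepted input every block meets the grid holding a cross, so there are at most \<open>n\<close> disjoint
  blocks. At a rejected input each block creates a cross in some grid, and no grid serves four
  disjoint blocks, say with crosses \<open>s, t, u, v\<close>: the cell \<open>(s, t)\<close> lies in the crosses \<open>s\<close> and \<open>t\<close> but
  not in \<open>u\<close> and \<open>v\<close>, so either the first two or the last two blocks both flip it. Hence block
  sensitivity is at most \<open>3 n\<close>. At the zero input each cell lies in at most two crosses, so weight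
  \<open>1/2\<close> on each of the \<open>n m\<close> crosses is a fractional packing of value \<open>n\<^sup>3\<^sup>/\<^sup>2 / 2\<close>.
\<close>

lemma finite_cube: "finite (cube N)"
  unfolding cube_def using finite_lists_length_eq[of "UNIV :: bool set" N] by simp

lemma cube_nonempty: "cube N \<noteq> {}"
  unfolding cube_def using length_replicate[of N True] by blast

lemma bs_le:
  assumes "\<And>x P. x \<in> cube N \<Longrightarrow> P \<subseteq> blocks N f x \<Longrightarrow> disjoint P \<Longrightarrow> card P \<le> b"
  shows "bs N f \<le> b"
proof -
  have "bs_at N f x \<le> b" if "x \<in> cube N" for x
  proof -
    let ?S = "{card P | P. P \<subseteq> blocks N f x \<and> disjoint P}"
    have "?S \<subseteq> card ` Pow (blocks N f x)" by auto
    then have "finite ?S"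
      by (rule finite_subset) (simp add: finite_blocks)
    moreover have "card ({} :: nat set set) \<in> ?S"
      by (intro CollectI exI[of _ "{}"]) (auto simp: disjoint_def)
    ultimately show ?thesis
      unfolding bs_at_def using assms that by (subst Max_le_iff) auto
  qed
  then show ?thesis
    unfolding bs_def by (subst Max_le_iff) (auto simp: finite_cube cube_nonempty)
qed

lemma sum_fractional_packing_le_bs_star:
  assumes "x \<in> cube N" "fractional_packing N f x w"
  shows "(\<Sum>B \<in> blocks N f x. w B) \<le> bs_star N f"
proof -
  have "(\<Sum>B \<in> blocks N f x. w B) \<le> bs_star_at N f x"
    unfolding bs_star_at_def
  proof (rule cSup_upper)
    show "bdd_above {(\<Sum>B \<in> blocks N f x. w B) | w. fractional_packing N f x w}"
      by (intro bdd_aboveI[of _ "real N"]) (auto simp: fractional_packing_le)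
  qed (use assms in auto)
  also have "\<dots> \<le> bs_star N f"
    unfolding bs_star_def using assms(1) by (intro Max_ge finite_imageI finite_cube) auto
  finally show ?thesis .
qed

lemma card_bounded_multiplicity_le_bs_star:
  assumes x: "x \<in> cube N" and F: "F \<subseteq> blocks N f x" and "d > 0"
    and multiplicity: "\<And>i. i < N \<Longrightarrow> card {B \<in> F. i \<in> B} \<le> d"
  shows "real (card F) / real d \<le> bs_star N f"
proof -
  define w :: "nat set \<Rightarrow> real" where "w B = (if B \<in> F then 1 / d else 0)" for B
  have sum_w: "(\<Sum>B \<in> X. w B) = card (X \<inter> F) / d" if "finite X" for X
    using that by (simp add: w_def sum.If_cases)
  have "fractional_packing N f x w"
    unfolding fractional_packing_def
  proof (intro conjI ballI allI impI)
    fix i assume "i < N"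
    have "{B \<in> blocks N f x. i \<in> B} \<inter> F = {B \<in> F. i \<in> B}"
      using F by blast
    then show "(\<Sum>B \<in> {B \<in> blocks N f x. i \<in> B}. w B) \<le> 1"
      using multiplicity[OF \<open>i < N\<close>] \<open>d > 0\<close> by (simp add: sum_w finite_blocks)
  qed (simp add: w_def)
  from sum_fractional_packing_le_bs_star[OF x this] show ?thesis
    using F by (simp add: sum_w finite_blocks Int_absorb1)
qed

lemma card_disjoint_blocks_le_certificate:
  assumes "finite C" and certificate: "\<And>B. B \<subseteq> {..<N} \<Longrightarrow> B \<inter> C = {} \<Longrightarrow> f (flip x B) = f x"
    and P: "P \<subseteq> blocks N f x" "disjoint P"
  shows "card P \<le> card C"
proof (rule card_le_if_inj_on_rel[where r = "\<lambda>B i. i \<in> B"])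
  show "\<exists>i. i \<in> C \<and> i \<in> B" if "B \<in> P" for B
    using that P(1) certificate[of B] by (auto simp: blocks_def)
  show "B = B'" if "B \<in> P" "B' \<in> P" "i \<in> C" "i \<in> B" "i \<in> B'" for B B' i
    using that P(2) by (auto simp: disjoint_def)
qed (fact \<open>finite C\<close>)

text \<open>
  The measure \<open>b\<close> takes natural values because \<open>b powr r \<le> b powr s\<close> for \<open>r \<le> s\<close> can fail when \<open>0 < b < 1\<close>.
\<close>

lemma le_exp_positive_constant:
  assumes "le_exp r a (\<lambda>N f. real (b N f))" "r \<le> s"
  obtains C where "C > 0" "\<And>N f. a N f \<le> C * (real (b N f) powr s + 1)"
proof -
  obtain C D where CD: "\<And>N f. a N f \<le> C * real (b N f) powr r + D"
    using assms(1) by (auto simp: le_exp_def)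
  have "a N f \<le> (\<bar>C\<bar> + \<bar>D\<bar> + 1) * (real (b N f) powr s + 1)" for N f
  proof -
    have "real (b N f) powr r \<le> real (b N f) powr s"
      using \<open>r \<le> s\<close> by (cases "b N f = 0") (auto intro: powr_mono)
    then have "C * real (b N f) powr r \<le> (\<bar>C\<bar> + \<bar>D\<bar> + 1) * real (b N f) powr s"
      by (intro mult_mono) auto
    then show ?thesis using CD[of N f] by (simp add: distrib_left)
  qed
  then show ?thesis by (intro that[of "\<bar>C\<bar> + \<bar>D\<bar> + 1"]) auto
qed

lemma crit_ge:
  assumes "c > 0" "c' > 0" "p > 0"
    and gap: "infinite {n. \<exists>N f. real (b N f) \<le> c * real n \<and> c' * real n powr p \<le> a N f}"
  shows "ereal p \<le> crit a (\<lambda>N f. real (b N f))"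
proof -
  have "p \<le> r" if le_exp_r: "le_exp r a (\<lambda>N f. real (b N f))" for r
  proof (rule ccontr)
    assume "\<not> p \<le> r"
    then obtain s where s: "0 < s" "r < s" "s < p"
      using dense[of "max r 0" p] \<open>p > 0\<close> by auto
    obtain C where "C > 0" and upper: "\<And>N f. a N f \<le> C * (real (b N f) powr s + 1)"
      using le_exp_positive_constant[OF le_exp_r less_imp_le[OF \<open>r < s\<close>]] by blast
    have "\<forall>\<^sub>F n in sequentially. C * ((c * real n) powr s + 1) < c' * real n powr p"
      using s assms(1,2) \<open>C > 0\<close> by real_asymp
    moreover have "\<exists>\<^sub>F n in sequentially. \<exists>N f. real (b N f) \<le> c * real n \<and> c' * real n powr p \<le> a N f"
      using gap by (simp add: frequently_cofinite flip: cofinite_eq_sequentially)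
    ultimately obtain n N f where growth: "C * ((c * real n) powr s + 1) < c' * real n powr p"
      and "real (b N f) \<le> c * real n" and lower: "c' * real n powr p \<le> a N f"
      by (blast dest: frequently_eventually_frequently frequently_ex)
    then have "C * (real (b N f) powr s + 1) \<le> C * ((c * real n) powr s + 1)"
      using s(1) \<open>C > 0\<close> by (intro mult_left_mono add_right_mono powr_mono2) auto
    then show False
      using upper[of N f] growth lower by linarith
  qed
  then show ?thesis
    unfolding crit_def by (intro Inf_greatest) auto
qed

definition ones :: "bool list \<Rightarrow> nat set" where
  "ones x = {i. i < length x \<and> x ! i}"

lemma ones_flip: "B \<subseteq> {..<length x} \<Longrightarrow> ones (flip x B) = sym_diff (ones x) B"
  by (auto simp: ones_def flip_def)

lemma ones_replicate_False: "ones (replicate N False) = {}"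
  by (auto simp: ones_def)

lemma disjoint_equal_completions_trivial:
  assumes "B \<inter> B' = {}" "sym_diff X B \<inter> G = A" "sym_diff X B' \<inter> G = A"
  shows "X \<inter> G = A"
  using assms unfolding set_eq_iff by blast

lemma card_disjoint_completions_le_3:
  assumes "disjoint Q"
    and completes: "\<And>B. B \<in> Q \<Longrightarrow> \<exists>v\<in>V. sym_diff X B \<inter> G = A v"
    and incomplete: "\<And>v. v \<in> V \<Longrightarrow> X \<inter> G \<noteq> A v"
    and uncovered: "\<And>s t u v. {s, t, u, v} \<subseteq> V \<Longrightarrow> {s, t} \<inter> {u, v} = {} \<Longrightarrow>
      \<not> A s \<inter> A t \<subseteq> A u \<union> A v"
  shows "card Q \<le> 3"
proof (rule ccontr)
  assume "\<not> card Q \<le> 3"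
  then have "Suc (Suc (Suc (Suc 0))) \<le> card Q" by simp
  then obtain T where "T \<subseteq> Q" and "card T = Suc (Suc (Suc (Suc 0)))"
    by (rule obtain_subset_with_card_n)
  from \<open>card T = _\<close> obtain B\<^sub>s B\<^sub>t B\<^sub>u B\<^sub>v where "T = {B\<^sub>s, B\<^sub>t, B\<^sub>u, B\<^sub>v}"
    and distinct: "B\<^sub>s \<notin> {B\<^sub>t, B\<^sub>u, B\<^sub>v}" "B\<^sub>t \<notin> {B\<^sub>u, B\<^sub>v}" "B\<^sub>u \<noteq> B\<^sub>v"
    unfolding card_Suc_eq by blast
  with \<open>T \<subseteq> Q\<close> have in_Q: "{B\<^sub>s, B\<^sub>t, B\<^sub>u, B\<^sub>v} \<subseteq> Q" by simp
  obtain h where h_in: "\<And>B. B \<in> Q \<Longrightarrow> h B \<in> V"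
    and completes_h: "\<And>B. B \<in> Q \<Longrightarrow> sym_diff X B \<inter> G = A (h B)"
    using completes by metis
  have flips: "i \<in> B \<longleftrightarrow> (i \<in> X) \<noteq> (i \<in> A (h B))" if "B \<in> Q" "i \<in> G" for B i
    using that by (auto simp: completes_h[symmetric])
  have disjnt: "B \<inter> B' = {}" if "B \<in> Q" "B' \<in> Q" "B \<noteq> B'" for B B'
    using \<open>disjoint Q\<close> that by (rule disjointD)
  have h_inj: "h B \<noteq> h B'" if "B \<in> Q" "B' \<in> Q" "B \<noteq> B'" for B B'
    using disjoint_equal_completions_trivial[OF disjnt[OF that]] completes_h incomplete h_in that
    by metis
  have "{h B\<^sub>s, h B\<^sub>t} \<inter> {h B\<^sub>u, h B\<^sub>v} = {}"
    using in_Q distinct h_inj[of B\<^sub>s] h_inj[of B\<^sub>t] by auto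
  then obtain i where i: "i \<in> A (h B\<^sub>s)" "i \<in> A (h B\<^sub>t)" "i \<notin> A (h B\<^sub>u)" "i \<notin> A (h B\<^sub>v)"
    using uncovered[of "h B\<^sub>s" "h B\<^sub>t" "h B\<^sub>u" "h B\<^sub>v"] h_in in_Q by auto
  moreover have "i \<in> G"
    using i(1) completes_h[of B\<^sub>s] in_Q by auto
  ultimately have "i \<in> B\<^sub>u \<and> i \<in> B\<^sub>v \<or> i \<in> B\<^sub>s \<and> i \<in> B\<^sub>t"
    using flips in_Q by (cases "i \<in> X") auto
  then show False
    using disjnt[of B\<^sub>u B\<^sub>v] disjnt[of B\<^sub>s B\<^sub>t] in_Q distinct by auto
qed

definition grid :: "nat \<Rightarrow> nat \<Rightarrow> nat set" where
  "grid m k = {k * m\<^sup>2..<Suc k * m\<^sup>2}"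

text \<open>The cell in row \<open>a\<close> and column \<open>b\<close> of grid \<open>k\<close> is bit \<open>(k m + a) m + b\<close>.\<close>

definition cross :: "nat \<Rightarrow> nat \<Rightarrow> nat \<Rightarrow> nat set" where
  "cross m k v = {i \<in> grid m k. i div m mod m = v \<or> i mod m = v}"

definition has_cross :: "nat \<Rightarrow> nat \<Rightarrow> bool list \<Rightarrow> bool" where
  "has_cross K m x \<longleftrightarrow> (\<exists>k<K. \<exists>v<m. ones x \<inter> grid m k = cross m k v)"

lemma finite_grid: "finite (grid m k)"
  by (simp add: grid_def)

lemma card_grid: "card (grid m k) = m\<^sup>2"
  by (simp add: grid_def)

lemma grid_subset: "k < K \<Longrightarrow> grid m k \<subseteq> {..<K * m\<^sup>2}"
  using mult_le_mono1[of "Suc k" K "m\<^sup>2"] by (auto simp: grid_def)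

lemma grid_index: "i \<in> grid m k \<Longrightarrow> i div m\<^sup>2 = k"
  by (intro div_nat_eqI) (auto simp: grid_def mult.commute)

lemma cross_subset_grid: "cross m k v \<subseteq> grid m k"
  by (auto simp: cross_def)

lemma grid_cell_exists:
  assumes "a < m" "b < m"
  shows "\<exists>i\<in>grid m k. i div m mod m = a \<and> i mod m = b"
proof
  have "a * m + b < Suc a * m" using \<open>b < m\<close> by simp
  also have "\<dots> \<le> m * m" using \<open>a < m\<close> by (intro mult_le_mono1) simp
  finally show "(k * m + a) * m + b \<in> grid m k"
    by (simp add: grid_def power2_eq_square algebra_simps)
qed (use assms in simp)

lemma inj_on_cross: "inj_on (\<lambda>(k, v). cross m k v) (UNIV \<times> {..<m})"
proof (rule inj_onI, clarsimp)
  fix k v k' v'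
  assume "v < m" and eq: "cross m k v = cross m k' v'"
  then obtain i where i: "i \<in> grid m k" "i div m mod m = v" "i mod m = v"
    using grid_cell_exists by blast
  then have "i \<in> cross m k' v'"
    using eq by (auto simp: cross_def)
  then show "k = k' \<and> v = v'"
    using i grid_index[of i m k] grid_index[of i m k'] by (auto simp: cross_def)
qed

lemma crosses_through_cell:
  "i \<in> cross m k v \<Longrightarrow> cross m k v \<in> {cross m (i div m\<^sup>2) (i div m mod m), cross m (i div m\<^sup>2) (i mod m)}"
  using grid_index by (auto simp: cross_def)

lemma two_crosses_not_covered:
  assumes "s < m" "t < m" "{s, t} \<inter> {u, v} = {}"
  shows "\<not> cross m k s \<inter> cross m k t \<subseteq> cross m k u \<union> cross m k v"
proof -
  obtain i where "i \<in> grid m k" "i div m mod m = s" "i mod m = t"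
    using grid_cell_exists[OF assms(1,2)] by blast
  then have "i \<in> cross m k s \<inter> cross m k t - (cross m k u \<union> cross m k v)"
    using assms(3) by (auto simp: cross_def)
  then show ?thesis by blast
qed

lemma card_disjoint_blocks_has_cross_le:
  assumes "has_cross K m x" and x: "x \<in> cube (K * m\<^sup>2)"
    and P: "P \<subseteq> blocks (K * m\<^sup>2) (has_cross K m) x" "disjoint P"
  shows "card P \<le> m\<^sup>2"
proof -
  obtain k v where kv: "k < K" "v < m" "ones x \<inter> grid m k = cross m k v"
    using \<open>has_cross K m x\<close> by (auto simp: has_cross_def)
  have "card P \<le> card (grid m k)"
  proof (rule card_disjoint_blocks_le_certificate[OF finite_grid _ P])
    fix B assume B: "B \<subseteq> {..<K * m\<^sup>2}" "B \<inter> grid m k = {}"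
    then have "ones (flip x B) = sym_diff (ones x) B"
      using x by (intro ones_flip) (simp add: cube_def)
    then have "ones (flip x B) \<inter> grid m k = cross m k v"
      using B(2) kv(3) by blast
    then show "has_cross K m (flip x B) = has_cross K m x"
      using kv \<open>has_cross K m x\<close> by (auto simp: has_cross_def)
  qed
  then show ?thesis by (simp add: card_grid)
qed

lemma card_disjoint_blocks_no_cross_le:
  assumes no_cross: "\<not> has_cross K m x" and x: "x \<in> cube (K * m\<^sup>2)"
    and P: "P \<subseteq> blocks (K * m\<^sup>2) (has_cross K m) x" "disjoint P"
  shows "card P \<le> 3 * K"
proof -
  define Q where "Q k = {B \<in> P. \<exists>v\<in>{..<m}. sym_diff (ones x) B \<inter> grid m k = cross m k v}" for k
  have covered: "\<exists>k<K. B \<in> Q k" if "B \<in> P" for B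
  proof -
    have "B \<subseteq> {..<length x}" "has_cross K m (flip x B)"
      using that P(1) no_cross x by (auto simp: blocks_def cube_def)
    then show ?thesis
      using that by (auto simp: has_cross_def ones_flip Q_def)
  qed
  have "Q k \<subseteq> P" for k by (auto simp: Q_def)
  then have "P = (\<Union>k<K. Q k)"
    using covered by blast
  then have "card P \<le> (\<Sum>k<K. card (Q k))"
    using card_UN_le[of "{..<K}" Q] by simp
  also have "\<dots> \<le> (\<Sum>k<K. 3)"
  proof (rule sum_mono)
    fix k assume "k \<in> {..<K}"
    show "card (Q k) \<le> 3"
    proof (rule card_disjoint_completions_le_3)
      show "disjoint (Q k)"
        using P(2) by (auto simp: Q_def disjoint_def)
      show "ones x \<inter> grid m k \<noteq> cross m k v" if "v \<in> {..<m}" for v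
        using no_cross that \<open>k \<in> {..<K}\<close> by (auto simp: has_cross_def)
    qed (use two_crosses_not_covered in \<open>auto simp: Q_def\<close>)
  qed
  finally show ?thesis by simp
qed

lemma bs_has_cross_le: "bs (K * m\<^sup>2) (has_cross K m) \<le> max (m\<^sup>2) (3 * K)"
  using card_disjoint_blocks_has_cross_le card_disjoint_blocks_no_cross_le
  by (intro bs_le) (metis max.coboundedI1 max.coboundedI2)

lemma cross_mem_blocks_zero:
  assumes "k < K" "v < m"
  shows "cross m k v \<in> blocks (K * m\<^sup>2) (has_cross K m) (replicate (K * m\<^sup>2) False)"
proof -
  let ?x = "replicate (K * m\<^sup>2) False"
  have sub: "cross m k v \<subseteq> {..<K * m\<^sup>2}"
    using cross_subset_grid grid_subset[OF \<open>k < K\<close>] by (rule subset_trans)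
  then have "ones (flip ?x (cross m k v)) = cross m k v"
    by (simp add: ones_flip ones_replicate_False)
  then have "ones (flip ?x (cross m k v)) \<inter> grid m k = cross m k v"
    using cross_subset_grid by (simp add: Int_absorb2)
  then have "has_cross K m (flip ?x (cross m k v))"
    using assms by (auto simp: has_cross_def)
  moreover have "cross m k' v' \<noteq> {}" if "v' < m" for k' v'
    using two_crosses_not_covered[OF that that, of m m] that by auto
  then have "\<not> has_cross K m ?x"
    by (auto simp: has_cross_def ones_replicate_False)
  ultimately show ?thesis
    using sub by (simp add: blocks_def)
qed

lemma bs_star_has_cross_ge: "real (K * m) / 2 \<le> bs_star (K * m\<^sup>2) (has_cross K m)"
proof -
  define F where "F = (\<lambda>(k, v). cross m k v) ` ({..<K} \<times> {..<m})"
  have "card {B \<in> F. i \<in> B} \<le> 2" for i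
  proof -
    let ?C = "{cross m (i div m\<^sup>2) (i div m mod m), cross m (i div m\<^sup>2) (i mod m)}"
    have "{B \<in> F. i \<in> B} \<subseteq> ?C"
      unfolding F_def using crosses_through_cell by blast
    then have "card {B \<in> F. i \<in> B} \<le> card ?C"
      by (intro card_mono) auto
    also have "\<dots> \<le> 2" by (simp add: card_insert_if)
    finally show ?thesis .
  qed
  then have "real (card F) / real 2 \<le> bs_star (K * m\<^sup>2) (has_cross K m)"
    by (intro card_bounded_multiplicity_le_bs_star[of "replicate (K * m\<^sup>2) False"])
      (auto simp: F_def cube_def cross_mem_blocks_zero)
  moreover have "card F = K * m"
    unfolding F_def by (subst card_image[OF inj_on_subset[OF inj_on_cross]])
      (auto simp: card_cartesian_product)
  ultimately show ?thesis by simp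
qed

lemma has_cross_gap:
  shows "real (bs ((m\<^sup>2)\<^sup>2) (has_cross (m\<^sup>2) m)) \<le> 3 * real (m\<^sup>2)"
    and "1 / 2 * real (m\<^sup>2) powr (3 / 2) \<le> bs_star ((m\<^sup>2)\<^sup>2) (has_cross (m\<^sup>2) m)"
proof -
  have size: "(m\<^sup>2)\<^sup>2 = m\<^sup>2 * m\<^sup>2" by (rule power2_eq_square)
  have "bs ((m\<^sup>2)\<^sup>2) (has_cross (m\<^sup>2) m) \<le> 3 * m\<^sup>2"
    unfolding size using bs_has_cross_le[of "m\<^sup>2" m] by simp
  then show "real (bs ((m\<^sup>2)\<^sup>2) (has_cross (m\<^sup>2) m)) \<le> 3 * real (m\<^sup>2)"
    by linarith
  have "real (m\<^sup>2) powr (3 / 2) = (real m powr 2) powr (3 / 2)" by simp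
  also have "\<dots> = real m powr 3" by (simp only: powr_powr) simp
  also have "\<dots> = real (m\<^sup>2 * m)" by (simp add: power3_eq_cube power2_eq_square)
  finally show "1 / 2 * real (m\<^sup>2) powr (3 / 2) \<le> bs_star ((m\<^sup>2)\<^sup>2) (has_cross (m\<^sup>2) m)"
    unfolding size using bs_star_has_cross_ge[of "m\<^sup>2" m] by simp
qed

theorem mainTheorem5:
  "(\<exists>c c' :: real. c > 0 \<and> c' > 0 \<and>
      infinite {n :: nat. \<exists>f :: bool list \<Rightarrow> bool.
        real (bs (n\<^sup>2) f) \<le> c * real n \<and> bs_star (n\<^sup>2) f \<ge> c' * real n powr (3 / 2)})
   \<and> crit bs_star (\<lambda>N f. real (bs N f)) \<ge> ereal (3 / 2)"
proof
  let ?gap = "\<lambda>c c' n f. real (bs (n\<^sup>2) f) \<le> c * real n \<and> bs_star (n\<^sup>2) f \<ge> c' * real n powr (3 / 2)"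
  have "range power2 \<subseteq> {n. \<exists>f. ?gap 3 (1 / 2) n f}"
    using has_cross_gap by blast
  moreover have "infinite (range (power2 :: nat \<Rightarrow> nat))"
    by (intro range_inj_infinite injI) simp
  ultimately have infinite_gap: "infinite {n. \<exists>f. ?gap 3 (1 / 2) n f}"
    by (rule infinite_super)
  then show "\<exists>c c' :: real. c > 0 \<and> c' > 0 \<and> infinite {n. \<exists>f. ?gap c c' n f}"
    by (intro exI[of _ 3] exI[of _ "1 / 2"]) simp
  have "infinite {n. \<exists>N f. real (bs N f) \<le> 3 * real n \<and> 1 / 2 * real n powr (3 / 2) \<le> bs_star N f}"
    by (rule infinite_super[OF _ infinite_gap]) blast
  then show "crit bs_star (\<lambda>N f. real (bs N f)) \<ge> ereal (3 / 2)"
    by (rule crit_ge[rotated 3]) simp_all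
qed

end
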